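(* Suppose that $f(\cdot;\xi)$ is $L$-smooth for every realization of $\xi$ (with $L>0$; no convexity is assumed). Let $w_0\in\mathbb{R}^d$ be given with $\mathbb{E}[\|\nabla f(w_0;\xi)\|^2]$ finite. Let $\tilde w$ be the output of iSARAH-IN$(w_0,\eta,m,b)$ with $0<\eta\le\frac{2}{L(\sqrt{1+4m}+1)}\le\frac1L$ and $b=\sqrt{m+1}$, where $m\ge1$ is such that $\sqrt{m+1}$ is an integer. Then $$\mathbb{E}[\|\nabla F(\tilde w)\|^2]\le\frac{2}{\eta(m+1)}[F(w_0)-F^*]+\frac{1}{\sqrt{m+1}}\,\mathbb{E}[\|\nabla f(w_0;\xi)\|^2],$$ where $F^*$ is any lower bound of $F$.
   Context: $\xi$ is a random variable; for each realization, $f(\cdot;\xi):\mathbb{R}^d\to\mathbb{R}$ is differentiable; $F(w)=\mathbb{E}[f(w;\xi)]$ is bounded below, and $\mathbb{E}[\nabla f(w;\xi)]=\nabla F(w)$ for every fixed $w\in\mathbb{R}^d$. $\|\cdot\|$ is the Euclidean norm. $L$-smooth for every realization means $\|\nabla f(w;\xi)-\nabla f(w';\xi)\|\le L\|w-w'\|$ for all $w,w'\in\mathbb{R}^d$ and every realization of $\xi$. The procedure iSARAH-IN$(w_0,\eta,m,b)$ (inner loop of the inexact SARAH algorithm) has parameters $\eta>0$ and positive integers $m,b$. Let $\zeta_1,\dots,\zeta_b,\xi_1,\xi_2,\dots$ be i.i.d. copies of $\xi$, independent of $w_0$. Set $$v_0=\frac1b\sum_{i=1}^b\nabla f(w_0;\zeta_i),\qquad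 w_1=w_0-\eta v_0,$$ and for $t\ge 1$ $$v_t=\nabla f(w_t;\xi_t)-\nabla f(w_{t-1};\xi_t)+v_{t-1},\qquad w_{t+1}=w_t-\eta v_t.$$ The output is $\tilde w=w_t$ with $t$ chosen uniformly at random from $\{0,1,\dots,m\}$, independently of everything else (only $w_0,\dots,w_m$ are needed to produce the output). *)

theory Defs
  imports "HOL-Probability.Probability"
begin

definition grad :: "('a::real_inner \<Rightarrow> real) \<Rightarrow> 'a \<Rightarrow> 'a" where
  "grad g w = (THE D. GDERIV g w :> D)"

lemma GDERIV_grad:
  fixes g :: "'a::euclidean_space \<Rightarrow> real"
  assumes "g differentiable (at w)"
  shows "GDERIV g w :> grad g w"
proof -
  obtain g' where g': "(g has_derivative g') (at w)"
    using assms by (auto simp: differentiable_def)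
  then have lin: "linear g'"
    by (rule has_derivative_linear)
  have "g' h = h \<bullet> adjoint g' 1" for h
    using adjoint_works[OF lin, of h 1] by (simp add: inner_commute)
  then have "g' = (\<lambda>h. h \<bullet> adjoint g' 1)" ..
  with g' have ex: "GDERIV g w :> adjoint g' 1"
    by (metis gderiv_def)
  have unique: "D = E" if "GDERIV g w :> D" "GDERIV g w :> E" for D E
  proof -
    have "(\<lambda>h. h \<bullet> D) = (\<lambda>h. h \<bullet> E)"
      using that by (auto simp: gderiv_def intro: has_derivative_unique)
    then show ?thesis
      by (metis vector_eq_ldot)
  qed
  show ?thesis
    unfolding grad_def by (rule theI) (use ex unique in blast)+
qed

text \<open>
  The random variable \<open>\<xi>\<close> enters through its law \<open>D\<close>, a probability measure on the space of
  realizations.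
\<close>

definition expected_loss :: "'x measure \<Rightarrow> ('a \<Rightarrow> 'x \<Rightarrow> real) \<Rightarrow> 'a \<Rightarrow> real" where
  "expected_loss D f w = (\<integral>x. f w x \<partial>D)"

text \<open>
  Here \<open>z\<close> and \<open>x\<close> are realized sample sequences: \<open>z 1, \<dots>, z b\<close> form the initial batch and
  \<open>x t\<close> is the sample drawn in step \<open>t \<ge> 1\<close>; \<open>z 0\<close> and \<open>x 0\<close> are never used.
\<close>

fun isarah_w :: "('a::real_inner \<Rightarrow> 'x \<Rightarrow> real) \<Rightarrow> 'a \<Rightarrow> real \<Rightarrow> nat \<Rightarrow> (nat \<Rightarrow> 'x) \<Rightarrow> (nat \<Rightarrow> 'x) \<Rightarrow> nat \<Rightarrow> 'a"
  and isarah_v :: "('a::real_inner \<Rightarrow> 'x \<Rightarrow> real) \<Rightarrow> 'a \<Rightarrow> real \<Rightarrow> nat \<Rightarrow> (nat \<Rightarrow> 'x) \<Rightarrow> (nat \<Rightarrow> 'x) \<Rightarrow> nat \<Rightarrow> 'a"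
where
  "isarah_w f w0 \<eta> b z x 0 = w0"
| "isarah_w f w0 \<eta> b z x (Suc t) =
     isarah_w f w0 \<eta> b z x t - \<eta> *\<^sub>R isarah_v f w0 \<eta> b z x t"
| "isarah_v f w0 \<eta> b z x 0 = (1 / real b) *\<^sub>R (\<Sum>i=1..b. grad (\<lambda>u. f u (z i)) w0)"
| "isarah_v f w0 \<eta> b z x (Suc t) =
     grad (\<lambda>u. f u (x (Suc t))) (isarah_w f w0 \<eta> b z x (Suc t))
     - grad (\<lambda>u. f u (x (Suc t))) (isarah_w f w0 \<eta> b z x t)
     + isarah_v f w0 \<eta> b z x t"

end

theory Submission
  imports Defs
begin

text \<open>
  The estimation error \<open>e\<^sub>t = v\<^sub>t - \<nabla>F(w\<^sub>t)\<close> is a martingale: given the past, its increment is the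
  centered version of \<open>\<nabla>f(w\<^sub>t\<^sub>+\<^sub>1; \<xi>) - \<nabla>f(w\<^sub>t; \<xi>)\<close>, whose norm is at most \<open>L\<eta>\<parallel>v\<^sub>t\<parallel>\<close>. Hence
  \<open>E\<parallel>e\<^sub>t\<parallel>\<^sup>2 \<le> E\<parallel>e\<^sub>0\<parallel>\<^sup>2 + L\<^sup>2\<eta>\<^sup>2 \<Sum>\<^sub>s\<^sub><\<^sub>t E\<parallel>v\<^sub>s\<parallel>\<^sup>2\<close>, and averaging over the batch bounds \<open>E\<parallel>e\<^sub>0\<parallel>\<^sup>2\<close> by
  \<open>E\<parallel>\<nabla>f(w\<^sub>0; \<xi>)\<parallel>\<^sup>2 / b\<close>. The descent lemma gives
  \<open>F(w\<^sub>t\<^sub>+\<^sub>1) \<le> F(w\<^sub>t) - \<eta>/2 \<parallel>\<nabla>F(w\<^sub>t)\<parallel>\<^sup>2 + \<eta>/2 \<parallel>e\<^sub>t\<parallel>\<^sup>2 - \<eta>/2 (1 - L\<eta>) \<parallel>v\<^sub>t\<parallel>\<^sup>2\<close>; summing over \<open>t \<le> m\<close>, the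
  terms in \<open>\<parallel>v\<^sub>t\<parallel>\<^sup>2\<close> cancel as soon as \<open>m L\<^sup>2\<eta>\<^sup>2 \<le> 1 - L\<eta>\<close>, which is the step size condition.
\<close>

section \<open>Joint measurability of Caratheodory integrands\<close>

text \<open>Replacing \<open>w\<close> by simple approximations \<open>s i w\<close> gives
  measurable functions, since \<open>s i\<close> has finite range; continuity in \<open>w\<close>
  makes \<open>g w x\<close> their pointwise limit. This is what allows stochastic gradients to be
  evaluated at random points.\<close>

lemma borel_measurable_pair_continuous:
  fixes g :: "'a::{metric_space, second_countable_topology} \<Rightarrow> 'x \<Rightarrow> 'b::metric_space"
  assumes meas: "\<And>w. g w \<in> borel_measurable D"
    and cont: "\<And>x. x \<in> space D \<Longrightarrow> continuous_on UNIV (\<lambda>w. g w x)"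
  shows "(\<lambda>(w, x). g w x) \<in> borel_measurable (borel \<Otimes>\<^sub>M D)"
proof -
  \<comment> \<open>The identity on \<open>'a\<close> is approximated; \<open>undefined\<close>
    stands for an arbitrary base point of the approximation.\<close>
  obtain s :: "nat \<Rightarrow> 'a \<Rightarrow> 'a" where s: "\<And>i. simple_function borel (s i)"
    and lim: "\<And>w. (\<lambda>i. s i w) \<longlonglongrightarrow> w"
    using borel_measurable_implies_sequence_metric[of "\<lambda>w::'a. w" borel undefined] by auto
  have "(\<lambda>p. g (s i (fst p)) (snd p)) \<in> borel_measurable (borel \<Otimes>\<^sub>M D)" for i
  proof -
    have "countable (range (s i))"
      using simple_functionD(1)[OF s[of i]] by (simp add: countable_finite)
    moreover have "s i \<in> measurable borel (count_space (range (s i)))"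
      using measurable_simple_function[OF s] by (auto simp: measurable_def)
    then have "(\<lambda>p. s i (fst p)) \<in> measurable (borel \<Otimes>\<^sub>M D) (count_space (range (s i)))"
      by (rule measurable_compose[OF measurable_fst])
    moreover have "(\<lambda>p. g w (snd p)) \<in> borel_measurable (borel \<Otimes>\<^sub>M D)" for w
      by (rule measurable_compose[OF measurable_snd meas])
    ultimately show ?thesis
      using measurable_compose_countable'[where f = "\<lambda>w p. g w (snd p)"
          and g = "\<lambda>p. s i (fst p)" and I = "range (s i)"]
      by blast
  qed
  moreover have "(\<lambda>i. g (s i (fst p)) (snd p)) \<longlonglongrightarrow> (case p of (w, x) \<Rightarrow> g w x)"
    if "p \<in> space (borel \<Otimes>\<^sub>M D)" for p
  proof -
    have "snd p \<in> space D"
      using that by (auto simp: space_pair_measure)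
    from cont[OF this] have "isCont (\<lambda>w. g w (snd p)) (fst p)"
      by (simp add: continuous_on_eq_continuous_at)
    from isCont_tendsto_compose[OF this lim] show ?thesis
      by (simp add: case_prod_beta)
  qed
  ultimately show ?thesis
    by (rule borel_measurable_LIMSEQ_metric)
qed

section \<open>Second moments, centering and conditional independence\<close>

lemma integrable_norm_sq_add:
  fixes a c :: "'o \<Rightarrow> 'a::euclidean_space"
  assumes [measurable]: "a \<in> borel_measurable M" "c \<in> borel_measurable M"
    and a: "integrable M (\<lambda>\<omega>. (norm (a \<omega>))\<^sup>2)" and c: "integrable M (\<lambda>\<omega>. (norm (c \<omega>))\<^sup>2)"
  shows "integrable M (\<lambda>\<omega>. (norm (a \<omega> + c \<omega>))\<^sup>2)"
proof (rule Bochner_Integration.integrable_bound)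
  show "integrable M (\<lambda>\<omega>. 2 * (norm (a \<omega>))\<^sup>2 + 2 * (norm (c \<omega>))\<^sup>2)"
    using a c by simp
  \<comment> \<open>Parallelogram law: the right side exceeds the left by the square of
    \<open>norm (x - y)\<close>.\<close>
  have "(norm (x + y))\<^sup>2 \<le> 2 * (norm x)\<^sup>2 + 2 * (norm y)\<^sup>2" for x y :: 'a
    using zero_le_power2[of "norm (x - y)"]
    by (simp add: power2_norm_eq_inner inner_add inner_diff inner_commute)
  then show "AE \<omega> in M. norm ((norm (a \<omega> + c \<omega>))\<^sup>2) \<le> norm (2 * (norm (a \<omega>))\<^sup>2 + 2 * (norm (c \<omega>))\<^sup>2)"
    by simp
qed simp

text \<open>Expanding the square leaves the cross term \<open>2 * (u \<bullet> \<mu>)\<close>. The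
  two uses are \<open>\<mu> = 0\<close>, where it vanishes (martingale increments), and
  \<open>u = - \<mu>\<close>, which is the variance formula.\<close>

lemma (in prob_space) norm_sq_add_centered:
  fixes h :: "'a \<Rightarrow> 'b::euclidean_space"
  assumes mean: "has_bochner_integral M h \<mu>" and sq: "integrable M (\<lambda>x. (norm (h x))\<^sup>2)"
  shows "has_bochner_integral M (\<lambda>x. (norm (u + h x))\<^sup>2)
      ((norm u)\<^sup>2 + 2 * (u \<bullet> \<mu>) + (\<integral>x. (norm (h x))\<^sup>2 \<partial>M))"
proof -
  have "(norm (u + h x))\<^sup>2 = (norm u)\<^sup>2 + 2 * (u \<bullet> h x) + (norm (h x))\<^sup>2" for x
    by (simp add: power2_norm_eq_inner inner_add inner_commute)
  moreover have "has_bochner_integral M (\<lambda>x. (norm u)\<^sup>2 + 2 * (u \<bullet> h x) + (norm (h x))\<^sup>2)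
      ((norm u)\<^sup>2 + 2 * (u \<bullet> \<mu>) + (\<integral>x. (norm (h x))\<^sup>2 \<partial>M))"
    using mean sq
    by (intro has_bochner_integral_add has_bochner_integral_mult_right
          has_bochner_integral_inner_right has_bochner_integral_integrable)
       (auto simp: has_bochner_integral_iff prob_space)
  ultimately show ?thesis by simp
qed

lemma (in prob_space) has_bochner_integral_centered:
  fixes h :: "'a \<Rightarrow> 'b::euclidean_space"
  assumes "has_bochner_integral M h \<mu>"
  shows "has_bochner_integral M (\<lambda>x. h x - \<mu>) 0"
  using assms by (auto simp: has_bochner_integral_iff prob_space)

lemma (in prob_space) norm_sq_centered_le:
  fixes h :: "'a \<Rightarrow> 'b::euclidean_space"
  assumes mean: "has_bochner_integral M h \<mu>" and sq: "integrable M (\<lambda>x. (norm (h x))\<^sup>2)"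
  shows "integrable M (\<lambda>x. (norm (h x - \<mu>))\<^sup>2)"
    and "(\<integral>x. (norm (h x - \<mu>))\<^sup>2 \<partial>M) \<le> (\<integral>x. (norm (h x))\<^sup>2 \<partial>M)"
  \<comment> \<open>With \<open>u = - \<mu>\<close> the first two terms add up to
    \<open>- (norm \<mu>)\<^sup>2\<close>, so centering can only lower the second moment.\<close>
  using norm_sq_add_centered[OF assms, of "- \<mu>"]
  by (simp_all add: has_bochner_integral_iff power2_norm_eq_inner)

text \<open>
  Conditionally on \<open>P\<close> the increment \<open>h (P, X)\<close> is centered, so the cross term vanishes.
\<close>

lemma (in prob_space) martingale_norm_sq_step:
  fixes u :: "'p \<Rightarrow> 'b::euclidean_space" and h :: "'p \<times> 'x \<Rightarrow> 'b"
  assumes joint: "distr M (N \<Otimes>\<^sub>M D) (\<lambda>\<omega>. (P \<omega>, X \<omega>)) = distr M N P \<Otimes>\<^sub>M D"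
    and distr: "distr M D X = D"
    and [measurable]: "P \<in> measurable M N" "X \<in> measurable M D"
    and [measurable]: "u \<in> borel_measurable N" "h \<in> borel_measurable (N \<Otimes>\<^sub>M D)"
      "q \<in> borel_measurable N"
    and mean: "\<And>p. p \<in> space N \<Longrightarrow> has_bochner_integral D (\<lambda>x. h (p, x)) 0"
    and sq: "\<And>p. p \<in> space N \<Longrightarrow> integrable D (\<lambda>x. (norm (h (p, x)))\<^sup>2)"
    and le: "\<And>p. p \<in> space N \<Longrightarrow> (\<integral>x. (norm (h (p, x)))\<^sup>2 \<partial>D) \<le> q p"
    and iu: "integrable M (\<lambda>\<omega>. (norm (u (P \<omega>)))\<^sup>2)" and iq: "integrable M (\<lambda>\<omega>. q (P \<omega>))"
  shows "integrable M (\<lambda>\<omega>. (norm (u (P \<omega>) + h (P \<omega>, X \<omega>)))\<^sup>2)" (is "integrable M ?k")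
    and "(\<integral>\<omega>. (norm (u (P \<omega>) + h (P \<omega>, X \<omega>)))\<^sup>2 \<partial>M)
      \<le> (\<integral>\<omega>. (norm (u (P \<omega>)))\<^sup>2 \<partial>M) + (\<integral>\<omega>. q (P \<omega>) \<partial>M)"
proof -
  interpret D: prob_space D
    using prob_space_distr[of X D] distr by simp
  have q0: "0 \<le> q p" if "p \<in> space N" for p
    using le[OF that] by (rule order_trans[rotated]) (simp add: integral_nonneg)
  have PN: "P \<omega> \<in> space N" if "\<omega> \<in> space M" for \<omega>
    using that by (rule measurable_space[rotated]) measurable
  have inner: "(\<integral>\<^sup>+x. ennreal ((norm (u p + h (p, x)))\<^sup>2) \<partial>D) \<le> ennreal ((norm (u p))\<^sup>2 + q p)"
    if p: "p \<in> space N" for p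
  proof -
    note hb = D.norm_sq_add_centered[OF mean[OF p] sq[OF p], of "u p"]
    have "(\<integral>\<^sup>+x. ennreal ((norm (u p + h (p, x)))\<^sup>2) \<partial>D)
        = ennreal ((norm (u p))\<^sup>2 + (\<integral>x. (norm (h (p, x)))\<^sup>2 \<partial>D))"
      using hb by (subst nn_integral_eq_integral) (auto simp: has_bochner_integral_iff)
    also have "\<dots> \<le> ennreal ((norm (u p))\<^sup>2 + q p)"
      using le[OF p] by (intro ennreal_leI) simp
    finally show ?thesis .
  qed
  \<comment> \<open>Nonnegative integrals permit iterated integration before \<open>?k\<close> is
    known to be integrable; the finite bound obtained this way then yields integrability.\<close>
  have "(\<integral>\<^sup>+\<omega>. ennreal (?k \<omega>) \<partial>M)
      = (\<integral>\<^sup>+y. ennreal ((norm (u (fst y) + h y))\<^sup>2) \<partial>distr M (N \<Otimes>\<^sub>M D) (\<lambda>\<omega>. (P \<omega>, X \<omega>)))"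
    by (subst nn_integral_distr) auto
  also have "\<dots> = (\<integral>\<^sup>+p. \<integral>\<^sup>+x. ennreal ((norm (u p + h (p, x)))\<^sup>2) \<partial>D \<partial>distr M N P)"
    unfolding joint by (subst D.nn_integral_fst[symmetric]) auto
  also have "\<dots> \<le> (\<integral>\<^sup>+p. ennreal ((norm (u p))\<^sup>2 + q p) \<partial>distr M N P)"
    by (intro nn_integral_mono inner) simp
  also have "\<dots> = (\<integral>\<^sup>+\<omega>. ennreal ((norm (u (P \<omega>)))\<^sup>2 + q (P \<omega>)) \<partial>M)"
    by (subst nn_integral_distr) auto
  also have "\<dots> = ennreal (\<integral>\<omega>. (norm (u (P \<omega>)))\<^sup>2 + q (P \<omega>) \<partial>M)"
    using iu iq q0 PN by (intro nn_integral_eq_integral) auto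
  also have "(\<integral>\<omega>. (norm (u (P \<omega>)))\<^sup>2 + q (P \<omega>) \<partial>M)
      = (\<integral>\<omega>. (norm (u (P \<omega>)))\<^sup>2 \<partial>M) + (\<integral>\<omega>. q (P \<omega>) \<partial>M)"
    using iu iq by simp
  finally have nn: "(\<integral>\<^sup>+\<omega>. ennreal (?k \<omega>) \<partial>M)
      \<le> ennreal ((\<integral>\<omega>. (norm (u (P \<omega>)))\<^sup>2 \<partial>M) + (\<integral>\<omega>. q (P \<omega>) \<partial>M))" .
  show int: "integrable M ?k"
    by (rule integrableI_nonneg) (use nn in \<open>auto simp: le_less_trans\<close>)
  have "0 \<le> (\<integral>\<omega>. q (P \<omega>) \<partial>M)"
    using q0 PN by (intro integral_nonneg_AE AE_I2) auto
  with nn show "(\<integral>\<omega>. ?k \<omega> \<partial>M) \<le> (\<integral>\<omega>. (norm (u (P \<omega>)))\<^sup>2 \<partial>M) + (\<integral>\<omega>. q (P \<omega>) \<partial>M)"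
    by (subst (asm) nn_integral_eq_integral[OF int])
       (auto simp: ennreal_le_iff simp del: ennreal_plus intro!: add_nonneg_nonneg)
qed

text \<open>
  Stated as a joint law because \<open>indep_var\<close> forces both variables to have the same type.
\<close>

lemma (in prob_space) joint_distr_restrict_component:
  assumes ind: "indep_vars (\<lambda>_. D) X I" and A: "j \<notin> A" "insert j A \<subseteq> I"
    and \<Phi>: "\<Phi> \<in> measurable (PiM A (\<lambda>_. D)) N"
  shows "distr M (N \<Otimes>\<^sub>M D) (\<lambda>\<omega>. (\<Phi> (restrict (\<lambda>i. X i \<omega>) A), X j \<omega>))
    = distr M N (\<lambda>\<omega>. \<Phi> (restrict (\<lambda>i. X i \<omega>) A)) \<Otimes>\<^sub>M distr M D (X j)"
proof -
  \<comment> \<open>\<open>X j\<close> is carried as the one-element family \<open>?Z\<close>, so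
    that both blocks are restrictions of the same independent family; evaluation at \<open>j\<close>
    recovers it.\<close>
  let ?A = "PiM A (\<lambda>_. D)" and ?B = "PiM {j} (\<lambda>_. D)"
  let ?Y = "\<lambda>\<omega>. restrict (\<lambda>i. X i \<omega>) A" and ?Z = "\<lambda>\<omega>. restrict (\<lambda>i. X i \<omega>) {j}"
  have iv: "indep_var ?A ?Y ?B ?Z"
    using ind A by (intro indep_var_restrict) auto
  then have Y: "?Y \<in> measurable M ?A" and Z: "?Z \<in> measurable M ?B"
    by (auto dest: indep_var_rv1 indep_var_rv2)
  have ev: "(\<lambda>y. y j) \<in> measurable ?B D"
    by (rule measurable_component_singleton) simp
  have dj: "distr B' D (\<lambda>y. y j) = distr M D (X j)" if "B' = distr M ?B ?Z" for B'
    unfolding that using distr_distr[OF ev Z] by (simp add: comp_def)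
  have dA: "distr (distr M ?A ?Y) N \<Phi> = distr M N (\<lambda>\<omega>. \<Phi> (?Y \<omega>))"
    using distr_distr[OF \<Phi> Y] by (simp add: comp_def)
  have pj: "prob_space (distr M D (X j))"
    using measurable_compose[OF Z ev] by (intro prob_space_distr) simp
  have "distr M N (\<lambda>\<omega>. \<Phi> (?Y \<omega>)) \<Otimes>\<^sub>M distr M D (X j)
      = distr (distr M ?A ?Y) N \<Phi> \<Otimes>\<^sub>M distr (distr M ?B ?Z) D (\<lambda>y. y j)"
    by (simp add: dA dj)
  also have "\<dots> = distr (distr M ?A ?Y \<Otimes>\<^sub>M distr M ?B ?Z) (N \<Otimes>\<^sub>M D) (\<lambda>(y, z). (\<Phi> y, z j))"
    using pj \<Phi> ev by (intro pair_measure_distr) (auto simp: dj prob_space_imp_sigma_finite)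
  also have "distr M ?A ?Y \<Otimes>\<^sub>M distr M ?B ?Z = distr M (?A \<Otimes>\<^sub>M ?B) (\<lambda>\<omega>. (?Y \<omega>, ?Z \<omega>))"
    using iv unfolding indep_var_distribution_eq by blast
  also have "distr \<dots> (N \<Otimes>\<^sub>M D) (\<lambda>(y, z). (\<Phi> y, z j))
      = distr M (N \<Otimes>\<^sub>M D) (\<lambda>\<omega>. (\<Phi> (?Y \<omega>), X j \<omega>))"
    using \<Phi> ev Y Z by (subst distr_distr) (auto simp: comp_def)
  finally show ?thesis ..
qed

section \<open>Deterministic facts: descent, dependence on past samples, step size\<close>

text \<open>Along the segment from \<open>w\<close> to \<open>w + d\<close>, removing the linear and
  quadratic terms leaves \<open>?\<phi>\<close>. Cauchy-Schwarz and the Lipschitz bound make its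
  derivative nonpositive; comparing the values at 0 and 1 gives the claim.\<close>

lemma smooth_descent:
  fixes F :: "'a::euclidean_space \<Rightarrow> real"
  assumes diff: "\<And>w. F differentiable (at w)"
    and lip: "\<And>w w'. norm (grad F w - grad F w') \<le> L * norm (w - w')"
  shows "F (w + d) \<le> F w + grad F w \<bullet> d + L / 2 * (norm d)\<^sup>2"
proof -
  let ?\<phi> = "\<lambda>s::real. F (w + s *\<^sub>R d) - s * (grad F w \<bullet> d) - L / 2 * s\<^sup>2 * (norm d)\<^sup>2"
  have "?\<phi> 0 \<ge> ?\<phi> 1"
  proof (rule DERIV_nonpos_imp_nonincreasing[of 0 1 ?\<phi>])
    fix s :: real assume s: "0 \<le> s" "s \<le> 1"
    have "(F has_derivative (\<lambda>h. h \<bullet> grad F (w + s *\<^sub>R d))) (at (w + s *\<^sub>R d))"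
      using GDERIV_grad[OF diff] by (simp add: gderiv_def)
    then have "((\<lambda>s. F (w + s *\<^sub>R d)) has_derivative (\<lambda>r. (r *\<^sub>R d) \<bullet> grad F (w + s *\<^sub>R d))) (at s)"
      by (rule has_derivative_compose[rotated]) (auto intro!: derivative_eq_intros)
    then have F': "((\<lambda>s. F (w + s *\<^sub>R d)) has_real_derivative d \<bullet> grad F (w + s *\<^sub>R d)) (at s)"
      by (simp add: has_field_derivative_def mult.commute[of "d \<bullet> _"] inner_commute
          mult_commute_abs)
    have "DERIV ?\<phi> s :> d \<bullet> grad F (w + s *\<^sub>R d) - grad F w \<bullet> d - L * s * (norm d)\<^sup>2"
      by (rule derivative_eq_intros F' refl | simp)+
    moreover have "d \<bullet> grad F (w + s *\<^sub>R d) - grad F w \<bullet> d - L * s * (norm d)\<^sup>2 \<le> 0"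
    proof -
      have "d \<bullet> grad F (w + s *\<^sub>R d) - grad F w \<bullet> d = d \<bullet> (grad F (w + s *\<^sub>R d) - grad F w)"
        by (simp add: inner_diff_right inner_commute)
      also have "\<dots> \<le> norm d * norm (grad F (w + s *\<^sub>R d) - grad F w)"
        by (rule norm_cauchy_schwarz)
      also have "\<dots> \<le> norm d * (L * norm (s *\<^sub>R d))"
        using lip[of "w + s *\<^sub>R d" w] by (intro mult_left_mono) auto
      also have "\<dots> = L * s * (norm d)\<^sup>2"
        using s by (simp add: power2_eq_square)
      finally show ?thesis by simp
    qed
    ultimately show "\<exists>y. DERIV ?\<phi> s :> y \<and> y \<le> 0" by blast
  qed simp
  then show ?thesis by simp
qed

text \<open>Adaptedness: the state at time \<open>t\<close> reads only the batch and the samples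
  \<open>1..t\<close>, which is why it is independent of sample \<open>Suc t\<close> later
  on.\<close>

lemma isarah_cong:
  assumes "\<And>i. i \<in> {1..b} \<Longrightarrow> z i = z' i" "\<And>s. s \<in> {1..t} \<Longrightarrow> x s = x' s"
  shows "isarah_w f w0 \<eta> b z x t = isarah_w f w0 \<eta> b z' x' t"
    and "isarah_v f w0 \<eta> b z x t = isarah_v f w0 \<eta> b z' x' t"
  using assms by (induction t) auto

text \<open>With \<open>s = sqrt (1 + 4 * real m)\<close>, the number \<open>2 / (s + 1)\<close> is
  the positive root of \<open>real m * a\<^sup>2 + a = 1\<close>, because
  \<open>(s - 1) * (s + 1) = 4 * real m\<close>. Below the root the left side is at most 1.\<close>

lemma isarah_step_size:
  fixes L \<eta> :: real
  assumes "L > 0" "0 < \<eta>" "\<eta> \<le> 2 / (L * (sqrt (1 + 4 * real m) + 1))"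
  shows "real m * (L * \<eta>)\<^sup>2 \<le> 1 - L * \<eta>"
proof -
  define s where "s = sqrt (1 + 4 * real m)"
  define a where "a = L * \<eta>"
  have s: "s \<ge> 1" "s\<^sup>2 = 1 + 4 * real m"
    by (simp_all add: s_def)
  have a: "a > 0" "a * (s + 1) \<le> 2"
    using assms s(1) unfolding s_def[symmetric] a_def
    by (simp_all add: pos_le_divide_eq mult_ac)
  have "4 * (real m * a\<^sup>2) = a * (s - 1) * (a * (s + 1))"
    using s(2) by (simp add: algebra_simps power2_eq_square)
  also have "\<dots> \<le> a * (s - 1) * 2"
    using a s by (intro mult_left_mono) auto
  \<comment> \<open>Here \<open>a * (s - 1) * 2\<close> equals
    \<open>2 * (a * (s + 1)) - 4 * a\<close>, so the step size bound applies once more.\<close>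
  also have "\<dots> \<le> 4 * (1 - a)"
    using a by (simp add: algebra_simps)
  finally show ?thesis by (simp add: a_def)
qed

section \<open>The probabilistic setting and measurability of the iterates\<close>

text \<open>Batch and step samples are indexed by one disjoint sum, so a single
  \<open>indep_vars\<close> expresses independence of the whole family. The random output index
  stays outside and enters only in \<open>uniform_output\<close>.\<close>

locale isarah = D: prob_space D + M: prob_space M
  for D :: "'x measure" and M :: "'o measure" +
  fixes f :: "'a::euclidean_space \<Rightarrow> 'x \<Rightarrow> real"
    and \<zeta> \<xi> :: "nat \<Rightarrow> 'o \<Rightarrow> 'x"
    and w0 :: 'a and L \<eta> :: real and b :: nat
  assumes F_diff: "\<And>w. expected_loss D f differentiable (at w)"
    and mean: "\<And>w. has_bochner_integral D (\<lambda>x. grad (\<lambda>u. f u x) w) (grad (expected_loss D f) w)"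
    and L_pos: "L > 0"
    and lip: "\<And>x w w'. x \<in> space D \<Longrightarrow>
      norm (grad (\<lambda>u. f u x) w - grad (\<lambda>u. f u x) w') \<le> L * norm (w - w')"
    and sq: "integrable D (\<lambda>x. (norm (grad (\<lambda>u. f u x) w0))\<^sup>2)"
    and indep: "M.indep_vars (\<lambda>_. D) (case_sum \<zeta> \<xi>) ({1..b} <+> {1..})"
    and distr_\<zeta>: "\<And>i. i \<in> {1..b} \<Longrightarrow> distr M D (\<zeta> i) = D"
    and distr_\<xi>: "\<And>t. t \<ge> 1 \<Longrightarrow> distr M D (\<xi> t) = D"
    and b_pos: "b > 0" and \<eta>_pos: "\<eta> > 0"
begin

abbreviation F :: "'a \<Rightarrow> real" where "F \<equiv> expected_loss D f"
abbreviation g :: "'a \<Rightarrow> 'x \<Rightarrow> 'a" where "g w x \<equiv> grad (\<lambda>u. f u x) w"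
abbreviation w :: "nat \<Rightarrow> 'o \<Rightarrow> 'a" where
  "w t \<omega> \<equiv> isarah_w f w0 \<eta> b (\<lambda>i. \<zeta> i \<omega>) (\<lambda>t. \<xi> t \<omega>) t"
abbreviation v :: "nat \<Rightarrow> 'o \<Rightarrow> 'a" where
  "v t \<omega> \<equiv> isarah_v f w0 \<eta> b (\<lambda>i. \<zeta> i \<omega>) (\<lambda>t. \<xi> t \<omega>) t"
abbreviation \<sigma> :: real where "\<sigma> \<equiv> \<integral>x. (norm (g w0 x))\<^sup>2 \<partial>D"
text \<open>The state as a deterministic function of the joint sample vector: measurability is
  proved on the product space, and independence is transported along this function.\<close>

abbreviation w_of :: "nat \<Rightarrow> (nat + nat \<Rightarrow> 'x) \<Rightarrow> 'a" where
  "w_of t y \<equiv> isarah_w f w0 \<eta> b (\<lambda>i. y (Inl i)) (\<lambda>t. y (Inr t)) t"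
abbreviation v_of :: "nat \<Rightarrow> (nat + nat \<Rightarrow> 'x) \<Rightarrow> 'a" where
  "v_of t y \<equiv> isarah_v f w0 \<eta> b (\<lambda>i. y (Inl i)) (\<lambda>t. y (Inr t)) t"

text \<open>The gradient of \<open>F\<close> is the mean of \<open>g\<close>, so the constant
  \<open>L\<close> survives by bounding the norm of an integral by the integral of the norm.\<close>

lemma grad_F_lipschitz: "norm (grad F u - grad F u') \<le> L * norm (u - u')"
proof -
  have hb: "has_bochner_integral D (\<lambda>x. g u x - g u' x) (grad F u - grad F u')"
    by (intro has_bochner_integral_diff mean)
  then have "norm (grad F u - grad F u') = norm (\<integral>x. g u x - g u' x \<partial>D)"
    by (simp add: has_bochner_integral_iff)
  also have "\<dots> \<le> (\<integral>x. norm (g u x - g u' x) \<partial>D)"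
    by (rule integral_norm_bound)
  also have "\<dots> \<le> (\<integral>x. L * norm (u - u') \<partial>D)"
    using hb by (intro integral_mono lip) (auto simp: has_bochner_integral_iff)
  finally show ?thesis by (simp add: D.prob_space)
qed

lemma grad_F_measurable [measurable]: "grad F \<in> borel_measurable borel"
proof (rule borel_measurable_continuous_onI)
  have "L-lipschitz_on UNIV (grad F)"
    using L_pos grad_F_lipschitz by (intro lipschitz_onI) (auto simp: dist_norm)
  then show "continuous_on UNIV (grad F)"
    by (rule lipschitz_on_continuous_on)
qed

lemma g_measurable: "g u \<in> borel_measurable D"
  using mean[of u] by (auto simp: has_bochner_integral_iff)

lemma g_pair_measurable [measurable]: "(\<lambda>(u, x). g u x) \<in> borel_measurable (borel \<Otimes>\<^sub>M D)"
proof (rule borel_measurable_pair_continuous)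
  fix x assume "x \<in> space D"
  then have "L-lipschitz_on UNIV (\<lambda>u. g u x)"
    using L_pos lip by (intro lipschitz_onI) (auto simp: dist_norm)
  then show "continuous_on UNIV (\<lambda>u. g u x)"
    by (rule lipschitz_on_continuous_on)
qed (rule g_measurable)

lemma g_compose_measurable:
  assumes "a \<in> borel_measurable N" "X \<in> measurable N D"
  shows "(\<lambda>y. g (a y) (X y)) \<in> borel_measurable N"
  using measurable_compose[OF measurable_Pair[OF assms] g_pair_measurable] by simp

text \<open>The index set \<open>A\<close> is left free to serve two purposes: the smallest choice
  isolates the past in \<open>state_joint_distr\<close>, the full index set gives measurability on
  \<open>M\<close>.\<close>

lemma state_measurable:
  assumes "{1..b} <+> {1..t} \<subseteq> A"
  shows "w_of t \<in> borel_measurable (PiM A (\<lambda>_. D))" "v_of t \<in> borel_measurable (PiM A (\<lambda>_. D))"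
proof -
  have "w_of t \<in> borel_measurable (PiM A (\<lambda>_. D)) \<and> v_of t \<in> borel_measurable (PiM A (\<lambda>_. D))"
    using assms
  proof (induction t)
    case 0
    then have "(\<lambda>y. y (Inl i)) \<in> measurable (PiM A (\<lambda>_. D)) D" if "i \<in> {1..b}" for i
      using that by (intro measurable_component_singleton) auto
    then have "(\<lambda>y. g w0 (y (Inl i))) \<in> borel_measurable (PiM A (\<lambda>_. D))" if "i \<in> {1..b}" for i
      using that by (intro measurable_compose[OF _ g_measurable]) auto
    then show ?case
      by (auto intro!: borel_measurable_sum borel_measurable_scaleR)
  next
    case (Suc t)
    then have "{1..b} <+> {1..t} \<subseteq> A" "Inr (Suc t) \<in> A"
      by auto
    with Suc.IH have [measurable]: "w_of t \<in> borel_measurable (PiM A (\<lambda>_. D))"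
      "v_of t \<in> borel_measurable (PiM A (\<lambda>_. D))"
      and X: "(\<lambda>y. y (Inr (Suc t))) \<in> measurable (PiM A (\<lambda>_. D)) D"
      by (auto intro: measurable_component_singleton)
    have w: "w_of (Suc t) \<in> borel_measurable (PiM A (\<lambda>_. D))"
      by simp
    moreover have "v_of (Suc t) \<in> borel_measurable (PiM A (\<lambda>_. D))"
      unfolding isarah_v.simps
      by (intro borel_measurable_add borel_measurable_diff g_compose_measurable w X) simp_all
    ultimately show ?case by blast
  qed
  then show "w_of t \<in> borel_measurable (PiM A (\<lambda>_. D))" "v_of t \<in> borel_measurable (PiM A (\<lambda>_. D))"
    by auto
qed

lemma sample_measurable:
  shows "i \<in> {1..b} \<Longrightarrow> \<zeta> i \<in> measurable M D" and "t \<ge> 1 \<Longrightarrow> \<xi> t \<in> measurable M D"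
  using indep unfolding M.indep_vars_def by force+

lemma samples_measurable:
  "A \<subseteq> {1..b} <+> {1..} \<Longrightarrow>
    (\<lambda>\<omega>. restrict (\<lambda>j. case_sum \<zeta> \<xi> j \<omega>) A) \<in> measurable M (PiM A (\<lambda>_. D))"
  using indep unfolding M.indep_vars_def by (intro measurable_restrict) auto

lemma w_eq_w_of: "{1..b} <+> {1..t} \<subseteq> A \<Longrightarrow> w t \<omega> = w_of t (restrict (\<lambda>j. case_sum \<zeta> \<xi> j \<omega>) A)"
  and v_eq_v_of: "{1..b} <+> {1..t} \<subseteq> A \<Longrightarrow> v t \<omega> = v_of t (restrict (\<lambda>j. case_sum \<zeta> \<xi> j \<omega>) A)"
  by (intro isarah_cong; force)+

lemma w_measurable [measurable]: "w t \<in> borel_measurable M"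
  and v_measurable [measurable]: "v t \<in> borel_measurable M"
proof -
  have sub: "{1..b} <+> {1..t} \<subseteq> {1..b} <+> {1..}" by auto
  note m = measurable_compose[OF samples_measurable[OF order_refl]]
  show "w t \<in> borel_measurable M" "v t \<in> borel_measurable M"
    unfolding w_eq_w_of[OF sub] v_eq_v_of[OF sub]
    by (intro m state_measurable[OF sub])+
qed

text \<open>The pair at time \<open>t\<close> is a function of the coordinates in \<open>?A\<close>,
  which omit \<open>Inr (Suc t)\<close>. Both components are kept because the next increment depends
  on the past through exactly this pair.\<close>

lemma state_joint_distr:
  "distr M ((borel \<Otimes>\<^sub>M borel) \<Otimes>\<^sub>M D) (\<lambda>\<omega>. ((w t \<omega>, v t \<omega>), \<xi> (Suc t) \<omega>))
    = distr M (borel \<Otimes>\<^sub>M borel) (\<lambda>\<omega>. (w t \<omega>, v t \<omega>)) \<Otimes>\<^sub>M D"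
proof -
  let ?A = "{1..b} <+> {1..t}"
  have "(\<lambda>y. (w_of t y, v_of t y)) \<in> measurable (PiM ?A (\<lambda>_. D)) (borel \<Otimes>\<^sub>M borel)"
    by (intro measurable_Pair state_measurable order_refl)
  moreover have "Inr (Suc t) \<notin> ?A" "insert (Inr (Suc t)) ?A \<subseteq> {1..b} <+> {1..}"
    by auto
  ultimately show ?thesis
    using M.joint_distr_restrict_component[OF indep, of "Inr (Suc t)" ?A
        "\<lambda>y. (w_of t y, v_of t y)" "borel \<Otimes>\<^sub>M borel"] distr_\<xi>[of "Suc t"]
    unfolding w_eq_w_of[OF order_refl] v_eq_v_of[OF order_refl]
    by (simp only: sum.case le_add1 plus_1_eq_Suc simp_thms not_False_eq_True True_implies_equals)
qed

section \<open>Variance of the gradient estimator and finiteness of second moments\<close>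

text \<open>The centered batch sums form a martingale too: each new sample is independent of the
  preceding partial sum and adds at most \<open>\<sigma>\<close>, since a variance is bounded by the
  second moment. Division by \<open>b\<close> is postponed so that the induction can run over
  partial sums.\<close>

lemma batch_norm_sq:
  assumes "k \<le> b"
  shows "integrable M (\<lambda>\<omega>. (norm (\<Sum>i=1..k. g w0 (\<zeta> i \<omega>) - grad F w0))\<^sup>2)
    \<and> (\<integral>\<omega>. (norm (\<Sum>i=1..k. g w0 (\<zeta> i \<omega>) - grad F w0))\<^sup>2 \<partial>M) \<le> real k * \<sigma>"
  using assms
proof (induction k)
  case (Suc k)
  let ?S = "\<lambda>\<omega>. \<Sum>i=1..k. g w0 (\<zeta> i \<omega>) - grad F w0"
  let ?h = "\<lambda>(_, x). g w0 x - grad F w0"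
  let ?A = "Inl ` {1..k} :: (nat + nat) set"
  let ?\<Phi> = "\<lambda>y. \<Sum>i=1..k. g w0 (y (Inl i)) - grad F w0"
  have [measurable]: "?\<Phi> \<in> borel_measurable (PiM ?A (\<lambda>_. D))"
    by (intro borel_measurable_sum borel_measurable_diff
        measurable_compose[OF _ g_measurable] measurable_component_singleton) auto
  have S: "?S \<omega> = ?\<Phi> (restrict (\<lambda>j. case_sum \<zeta> \<xi> j \<omega>) ?A)" for \<omega>
    by simp
  have joint: "distr M (borel \<Otimes>\<^sub>M D) (\<lambda>\<omega>. (?S \<omega>, \<zeta> (Suc k) \<omega>)) = distr M borel ?S \<Otimes>\<^sub>M D"
  proof -
    have "Inl (Suc k) \<notin> ?A" "insert (Inl (Suc k)) ?A \<subseteq> {1..b} <+> {1..}"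
      using Suc.prems by auto
    moreover have "distr M D (\<zeta> (Suc k)) = D"
      using Suc.prems by (intro distr_\<zeta>) auto
    ultimately show ?thesis
      using M.joint_distr_restrict_component[OF indep, of "Inl (Suc k)" ?A ?\<Phi> borel]
      unfolding S by (simp only: sum.case) measurable
  qed
  have [measurable]: "g w0 \<in> borel_measurable D" by (rule g_measurable)
  have \<zeta>: "\<zeta> i \<in> measurable M D" if "i \<in> {1..Suc k}" for i
    using that Suc.prems by (intro sample_measurable) auto
  have Sm: "?S \<in> borel_measurable M"
    by (intro borel_measurable_sum borel_measurable_diff
        measurable_compose[OF _ g_measurable] \<zeta>) auto
  have hb: "has_bochner_integral D (\<lambda>x. g w0 x - grad F w0) 0"
    by (rule D.has_bochner_integral_centered[OF mean])
  note c = D.norm_sq_centered_le[OF mean sq]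
  have "integrable M (\<lambda>\<omega>. (norm (?S \<omega> + ?h (?S \<omega>, \<zeta> (Suc k) \<omega>)))\<^sup>2)"
    "(\<integral>\<omega>. (norm (?S \<omega> + ?h (?S \<omega>, \<zeta> (Suc k) \<omega>)))\<^sup>2 \<partial>M) \<le> (\<integral>\<omega>. (norm (?S \<omega>))\<^sup>2 \<partial>M) + (\<integral>\<omega>. \<sigma> \<partial>M)"
    using Suc.IH Suc.prems
    by (intro M.martingale_norm_sq_step[OF joint, where u = "\<lambda>p. p" and h = ?h and q = "\<lambda>_. \<sigma>"]
        distr_\<zeta> Sm \<zeta>; simp add: hb c)+
  then show ?case
    using Suc by (auto simp: M.prob_space algebra_simps)
qed simp

lemma initial_variance:
  "integrable M (\<lambda>\<omega>. (norm (v 0 \<omega> - grad F w0))\<^sup>2)"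
  "(\<integral>\<omega>. (norm (v 0 \<omega> - grad F w0))\<^sup>2 \<partial>M) \<le> \<sigma> / b"
proof -
  have "v 0 \<omega> - grad F w0 = (1 / b) *\<^sub>R (\<Sum>i=1..b. g w0 (\<zeta> i \<omega>) - grad F w0)" for \<omega>
    using b_pos
    by (simp add: sum_subtractf scaleR_diff_right sum_constant_scaleR del: sum_constant)
  then have eq: "(norm (v 0 \<omega> - grad F w0))\<^sup>2
      = (1 / b)\<^sup>2 * (norm (\<Sum>i=1..b. g w0 (\<zeta> i \<omega>) - grad F w0))\<^sup>2" for \<omega>
    by (simp add: power_mult_distrib power_divide)
  show "integrable M (\<lambda>\<omega>. (norm (v 0 \<omega> - grad F w0))\<^sup>2)"
    unfolding eq using batch_norm_sq[of b] by simp
  have "(1 / b)\<^sup>2 * (\<integral>\<omega>. (norm (\<Sum>i=1..b. g w0 (\<zeta> i \<omega>) - grad F w0))\<^sup>2 \<partial>M)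
      \<le> (1 / b)\<^sup>2 * (b * \<sigma>)"
    using batch_norm_sq[of b] by (intro mult_left_mono) auto
  then show "(\<integral>\<omega>. (norm (v 0 \<omega> - grad F w0))\<^sup>2 \<partial>M) \<le> \<sigma> / b"
    unfolding eq using b_pos by (simp add: power2_eq_square)
qed

lemma variance_step:
  assumes int: "integrable M (\<lambda>\<omega>. (norm (v t \<omega> - grad F (w t \<omega>)))\<^sup>2)"
    and intv: "integrable M (\<lambda>\<omega>. (norm (v t \<omega>))\<^sup>2)"
  shows "integrable M (\<lambda>\<omega>. (norm (v (Suc t) \<omega> - grad F (w (Suc t) \<omega>)))\<^sup>2)"
    and "(\<integral>\<omega>. (norm (v (Suc t) \<omega> - grad F (w (Suc t) \<omega>)))\<^sup>2 \<partial>M)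
      \<le> (\<integral>\<omega>. (norm (v t \<omega> - grad F (w t \<omega>)))\<^sup>2 \<partial>M) + (L * \<eta>)\<^sup>2 * (\<integral>\<omega>. (norm (v t \<omega>))\<^sup>2 \<partial>M)"
proof -
  let ?N = "borel \<Otimes>\<^sub>M borel :: ('a \<times> 'a) measure"
  let ?P = "\<lambda>\<omega>. (w t \<omega>, v t \<omega>)" and ?X = "\<xi> (Suc t)"
  let ?u = "\<lambda>p::'a \<times> 'a. snd p - grad F (fst p)"
  let ?q = "\<lambda>p::'a \<times> 'a. (L * \<eta>)\<^sup>2 * (norm (snd p))\<^sup>2"
  \<comment> \<open>As \<open>w (Suc t)\<close> is \<open>fst p - \<eta> *\<^sub>R snd p\<close>,
    the gradient difference depends only on the pair \<open>p\<close> and the fresh sample;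
    \<open>?\<mu> p\<close> is its mean for fixed \<open>p\<close>.\<close>
  let ?d = "\<lambda>p x. g (fst p - \<eta> *\<^sub>R snd p) x - g (fst p) x"
  let ?\<mu> = "\<lambda>p. grad F (fst p - \<eta> *\<^sub>R snd p) - grad F (fst p)"
  let ?h = "\<lambda>(p, x). ?d p x - ?\<mu> p"
  have step: "?u (?P \<omega>) + ?h (?P \<omega>, ?X \<omega>) = v (Suc t) \<omega> - grad F (w (Suc t) \<omega>)" for \<omega>
    by simp
  have hm: "?h \<in> borel_measurable (?N \<Otimes>\<^sub>M D)"
    unfolding case_prod_beta
    by (intro borel_measurable_diff g_compose_measurable) measurable
  have d: "has_bochner_integral D (?d p) (?\<mu> p)" for p
    by (intro has_bochner_integral_diff mean)
  have dm: "?d p \<in> borel_measurable D" for p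
    using d[of p] by (auto simp: has_bochner_integral_iff)
  have bound: "(norm (?d p x))\<^sup>2 \<le> ?q p" if "x \<in> space D" for p x
  proof -
    have "norm (?d p x) \<le> L * \<eta> * norm (snd p)"
      using lip[OF that, of "fst p - \<eta> *\<^sub>R snd p" "fst p"] \<eta>_pos by simp
    from power_mono[OF this, of 2] show ?thesis
      by (simp add: power_mult_distrib)
  qed
  \<comment> \<open>For fixed \<open>p\<close> smoothness bounds \<open>?d p\<close>, so it is
    square integrable although \<open>sq\<close> speaks of \<open>w0\<close> only.\<close>
  have sqd: "integrable D (\<lambda>x. (norm (?d p x))\<^sup>2)" for p
    using dm[of p] bound by (intro D.integrable_const_bound[where B = "?q p"] AE_I2) auto
  have "(\<integral>x. (norm (?d p x))\<^sup>2 \<partial>D) \<le> (\<integral>x. ?q p \<partial>D)" for p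
    using sqd bound by (intro integral_mono) auto
  then have "(\<integral>x. (norm (?d p x - ?\<mu> p))\<^sup>2 \<partial>D) \<le> ?q p" for p
    using D.norm_sq_centered_le(2)[OF d sqd, of p] by (simp add: D.prob_space order_trans)
  moreover have "has_bochner_integral D (\<lambda>x. ?d p x - ?\<mu> p) 0" for p
    by (rule D.has_bochner_integral_centered[OF d])
  moreover have "integrable D (\<lambda>x. (norm (?d p x - ?\<mu> p))\<^sup>2)" for p
    by (rule D.norm_sq_centered_le(1)[OF d sqd])
  moreover have "distr M D ?X = D" "?X \<in> measurable M D"
    by (simp_all add: distr_\<xi> sample_measurable)
  moreover have "integrable M (\<lambda>\<omega>. ?q (?P \<omega>))" "integrable M (\<lambda>\<omega>. (norm (?u (?P \<omega>)))\<^sup>2)"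
    using int intv by simp_all
  moreover have "?u \<in> borel_measurable ?N" "?q \<in> borel_measurable ?N" "?P \<in> measurable M ?N"
    by measurable
  moreover note hm
  ultimately have "integrable M (\<lambda>\<omega>. (norm (?u (?P \<omega>) + ?h (?P \<omega>, ?X \<omega>)))\<^sup>2)"
    "(\<integral>\<omega>. (norm (?u (?P \<omega>) + ?h (?P \<omega>, ?X \<omega>)))\<^sup>2 \<partial>M)
      \<le> (\<integral>\<omega>. (norm (?u (?P \<omega>)))\<^sup>2 \<partial>M) + (\<integral>\<omega>. ?q (?P \<omega>) \<partial>M)"
    by (intro M.martingale_norm_sq_step[OF state_joint_distr, where u = ?u and h = ?h and q = ?q];
        simp only: prod.case)+
  then show "integrable M (\<lambda>\<omega>. (norm (v (Suc t) \<omega> - grad F (w (Suc t) \<omega>)))\<^sup>2)"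
    and "(\<integral>\<omega>. (norm (v (Suc t) \<omega> - grad F (w (Suc t) \<omega>)))\<^sup>2 \<partial>M)
      \<le> (\<integral>\<omega>. (norm (v t \<omega> - grad F (w t \<omega>)))\<^sup>2 \<partial>M) + (L * \<eta>)\<^sup>2 * (\<integral>\<omega>. (norm (v t \<omega>))\<^sup>2 \<partial>M)"
    unfolding step by simp_all
qed

text \<open>Square integrability is assumed at \<open>w0\<close> only and has to be propagated. The
  induction carries the true gradient and the error, whose sum is \<open>v t\<close>: in one step
  the gradient moves by at most \<open>L * \<eta> * norm (v t \<omega>)\<close>, and
  \<open>variance_step\<close> handles the error.\<close>

lemma second_moments:
  "integrable M (\<lambda>\<omega>. (norm (grad F (w t \<omega>)))\<^sup>2)"
  "integrable M (\<lambda>\<omega>. (norm (v t \<omega> - grad F (w t \<omega>)))\<^sup>2)"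
  "integrable M (\<lambda>\<omega>. (norm (v t \<omega>))\<^sup>2)"
proof -
  have v: "integrable M (\<lambda>\<omega>. (norm (v t \<omega>))\<^sup>2)"
    if "integrable M (\<lambda>\<omega>. (norm (grad F (w t \<omega>)))\<^sup>2)"
      "integrable M (\<lambda>\<omega>. (norm (v t \<omega> - grad F (w t \<omega>)))\<^sup>2)" for t
    using integrable_norm_sq_add[OF _ _ that] by simp
  have "integrable M (\<lambda>\<omega>. (norm (grad F (w t \<omega>)))\<^sup>2)
    \<and> integrable M (\<lambda>\<omega>. (norm (v t \<omega> - grad F (w t \<omega>)))\<^sup>2)"
  proof (induction t)
    case 0
    show ?case using initial_variance(1) by simp
  next
    case (Suc t)
    then have vt: "integrable M (\<lambda>\<omega>. (norm (v t \<omega>))\<^sup>2)"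
      using v by blast
    define \<Delta> where "\<Delta> \<omega> = grad F (w (Suc t) \<omega>) - grad F (w t \<omega>)" for \<omega>
    have [measurable]: "\<Delta> \<in> borel_measurable M"
      unfolding \<Delta>_def
      by (intro borel_measurable_diff measurable_compose[OF w_measurable grad_F_measurable])
    have bound: "(norm (\<Delta> \<omega>))\<^sup>2 \<le> (L * \<eta>)\<^sup>2 * (norm (v t \<omega>))\<^sup>2" for \<omega>
    proof -
      have "norm (\<Delta> \<omega>) \<le> L * \<eta> * norm (v t \<omega>)"
        using grad_F_lipschitz[of "w (Suc t) \<omega>" "w t \<omega>"] \<eta>_pos by (simp add: \<Delta>_def)
      from power_mono[OF this, of 2] show ?thesis
        by (simp add: power_mult_distrib)
    qed
    have "integrable M (\<lambda>\<omega>. (norm (\<Delta> \<omega>))\<^sup>2)"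
    proof (rule Bochner_Integration.integrable_bound)
      show "integrable M (\<lambda>\<omega>. (L * \<eta>)\<^sup>2 * (norm (v t \<omega>))\<^sup>2)"
        using vt by simp
      show "AE \<omega> in M. norm ((norm (\<Delta> \<omega>))\<^sup>2) \<le> norm ((L * \<eta>)\<^sup>2 * (norm (v t \<omega>))\<^sup>2)"
        using bound by (intro AE_I2) (simp add: abs_mult)
    qed measurable
    then have "integrable M (\<lambda>\<omega>. (norm (grad F (w t \<omega>) + \<Delta> \<omega>))\<^sup>2)"
      using Suc by (intro integrable_norm_sq_add) simp_all
    then have "integrable M (\<lambda>\<omega>. (norm (grad F (w (Suc t) \<omega>)))\<^sup>2)"
      by (simp add: \<Delta>_def)
    then show ?case
      using variance_step(1)[of t] Suc vt by blast
  qed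
  then show "integrable M (\<lambda>\<omega>. (norm (grad F (w t \<omega>)))\<^sup>2)"
    "integrable M (\<lambda>\<omega>. (norm (v t \<omega> - grad F (w t \<omega>)))\<^sup>2)"
    "integrable M (\<lambda>\<omega>. (norm (v t \<omega>))\<^sup>2)"
    using v by blast+
qed

lemma variance_bound:
  "(\<integral>\<omega>. (norm (v t \<omega> - grad F (w t \<omega>)))\<^sup>2 \<partial>M)
    \<le> \<sigma> / b + (L * \<eta>)\<^sup>2 * (\<Sum>s<t. \<integral>\<omega>. (norm (v s \<omega>))\<^sup>2 \<partial>M)"
proof (induction t)
  case 0
  show ?case using initial_variance(2) by simp
next
  case (Suc t)
  have "(\<integral>\<omega>. (norm (v (Suc t) \<omega> - grad F (w (Suc t) \<omega>)))\<^sup>2 \<partial>M)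
      \<le> (\<integral>\<omega>. (norm (v t \<omega> - grad F (w t \<omega>)))\<^sup>2 \<partial>M) + (L * \<eta>)\<^sup>2 * (\<integral>\<omega>. (norm (v t \<omega>))\<^sup>2 \<partial>M)"
    by (intro variance_step second_moments)
  with Suc show ?case
    by (simp add: distrib_left del: isarah_w.simps isarah_v.simps)
qed

section \<open>Summed descent and the bound on the gradient norms\<close>

text \<open>The inequality is pathwise, before any expectation: the descent inequality is scaled by
  \<open>2 / \<eta>\<close>, and the values of \<open>F\<close> telescope.\<close>

lemma descent_sum:
  "(\<Sum>t<n. (norm (grad F (w t \<omega>)))\<^sup>2) \<le> 2 / \<eta> * (F w0 - F (w n \<omega>))
    + (\<Sum>t<n. (norm (v t \<omega> - grad F (w t \<omega>)))\<^sup>2) - (1 - L * \<eta>) * (\<Sum>t<n. (norm (v t \<omega>))\<^sup>2)"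
proof (induction n)
  case (Suc n)
  let ?G = "grad F (w n \<omega>)" and ?v = "v n \<omega>"
  have "F (w (Suc n) \<omega>) \<le> F (w n \<omega>) - \<eta> * (?G \<bullet> ?v) + L / 2 * \<eta>\<^sup>2 * (norm ?v)\<^sup>2"
    using smooth_descent[OF F_diff grad_F_lipschitz, of "w n \<omega>" "- (\<eta> *\<^sub>R ?v)"]
    by (simp add: power_mult_distrib)
  then have "2 / \<eta> * F (w (Suc n) \<omega>)
      \<le> 2 / \<eta> * (F (w n \<omega>) - \<eta> * (?G \<bullet> ?v) + L / 2 * \<eta>\<^sup>2 * (norm ?v)\<^sup>2)"
    using \<eta>_pos by (intro mult_left_mono) auto
  also have "\<dots> = 2 / \<eta> * F (w n \<omega>) - 2 * (?G \<bullet> ?v) + L * \<eta> * (norm ?v)\<^sup>2"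
    using \<eta>_pos by (simp add: field_simps power2_eq_square)
  \<comment> \<open>Polarization trades the inner product for the squared gradient, the squared
    direction and the squared estimation error.\<close>
  also have "2 * (?G \<bullet> ?v) = (norm ?G)\<^sup>2 + (norm ?v)\<^sup>2 - (norm (?v - ?G))\<^sup>2"
    by (simp add: power2_norm_eq_inner inner_diff inner_commute)
  finally have "(norm ?G)\<^sup>2 \<le> 2 / \<eta> * F (w n \<omega>) - 2 / \<eta> * F (w (Suc n) \<omega>)
      + (norm (?v - ?G))\<^sup>2 - (1 - L * \<eta>) * (norm ?v)\<^sup>2"
    by (simp add: left_diff_distrib)
  with Suc show ?case
    unfolding sum.lessThan_Suc distrib_left right_diff_distrib by linarith
qed simp

lemma sum_grad_norm_sq_bound:
  assumes Fstar: "\<And>u. Fstar \<le> F u" and step: "real m * (L * \<eta>)\<^sup>2 \<le> 1 - L * \<eta>"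
  shows "(\<Sum>t\<le>m. \<integral>\<omega>. (norm (grad F (w t \<omega>)))\<^sup>2 \<partial>M)
    \<le> 2 / \<eta> * (F w0 - Fstar) + (real m + 1) * (\<sigma> / b)"
proof -
  define e where "e t = (\<integral>\<omega>. (norm (v t \<omega> - grad F (w t \<omega>)))\<^sup>2 \<partial>M)" for t
  define r where "r t = (\<integral>\<omega>. (norm (v t \<omega>))\<^sup>2 \<partial>M)" for t
  define R where "R = (\<Sum>t\<le>m. r t)"
  have r0: "0 \<le> r t" for t by (simp add: r_def)
  have "(\<Sum>t\<le>m. \<integral>\<omega>. (norm (grad F (w t \<omega>)))\<^sup>2 \<partial>M)
      = (\<integral>\<omega>. (\<Sum>t\<le>m. (norm (grad F (w t \<omega>)))\<^sup>2) \<partial>M)"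
    using second_moments by simp
  also have "\<dots> \<le> (\<integral>\<omega>. 2 / \<eta> * (F w0 - Fstar) + (\<Sum>t\<le>m. (norm (v t \<omega> - grad F (w t \<omega>)))\<^sup>2)
      - (1 - L * \<eta>) * (\<Sum>t\<le>m. (norm (v t \<omega>))\<^sup>2) \<partial>M)"
  proof (rule integral_mono)
    fix \<omega>
    \<comment> \<open>Summing over \<open>t \<le> m\<close> ends at the iterate
      \<open>w (Suc m)\<close>. Its value is replaced by \<open>Fstar\<close> pathwise, so that only
      second moments remain to be integrated.\<close>
    have "2 / \<eta> * (F w0 - F (w (Suc m) \<omega>)) \<le> 2 / \<eta> * (F w0 - Fstar)"
      using Fstar \<eta>_pos by (intro mult_left_mono) auto
    then show "(\<Sum>t\<le>m. (norm (grad F (w t \<omega>)))\<^sup>2)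
        \<le> 2 / \<eta> * (F w0 - Fstar) + (\<Sum>t\<le>m. (norm (v t \<omega> - grad F (w t \<omega>)))\<^sup>2)
          - (1 - L * \<eta>) * (\<Sum>t\<le>m. (norm (v t \<omega>))\<^sup>2)"
      using descent_sum[where n = "Suc m" and \<omega> = \<omega>] unfolding lessThan_Suc_atMost by linarith
  qed (use second_moments in auto)
  also have "\<dots> = 2 / \<eta> * (F w0 - Fstar) + (\<Sum>t\<le>m. e t) - (1 - L * \<eta>) * R"
    using second_moments by (simp add: e_def r_def R_def M.prob_space)
  also have "(\<Sum>t\<le>m. e t) \<le> (real m + 1) * (\<sigma> / b) + real m * (L * \<eta>)\<^sup>2 * R"
  proof -
    have "e t \<le> \<sigma> / b + (L * \<eta>)\<^sup>2 * R" if "t \<le> m" for t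
    proof -
      have "(\<Sum>s<t. r s) \<le> R"
        unfolding R_def using that r0 by (intro sum_mono2) auto
      then have "(L * \<eta>)\<^sup>2 * (\<Sum>s<t. r s) \<le> (L * \<eta>)\<^sup>2 * R"
        by (intro mult_left_mono) auto
      with variance_bound[of t] show ?thesis
        unfolding e_def r_def by linarith
    qed
    \<comment> \<open>The initial error \<open>e 0\<close> carries no share of \<open>R\<close>;
      only the other \<open>m\<close> errors do, which is why the step size condition has the factor
      \<open>m\<close> and not \<open>m + 1\<close>.\<close>
    then have "(\<Sum>t<m. e (Suc t)) \<le> (\<Sum>t<m. \<sigma> / b + (L * \<eta>)\<^sup>2 * R)"
      by (intro sum_mono) auto
    moreover have "e 0 \<le> \<sigma> / b"
      unfolding e_def using variance_bound[of 0] by simp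
    ultimately show ?thesis
      unfolding sum.atMost_shift by (simp add: algebra_simps add_divide_distrib)
  qed
  \<comment> \<open>The accumulated variance is absorbed by the negative term of the descent
    inequality.\<close>
  also have "real m * (L * \<eta>)\<^sup>2 * R \<le> (1 - L * \<eta>) * R"
    using step r0 unfolding R_def by (intro mult_right_mono sum_nonneg) auto
  finally show ?thesis by simp
qed

section \<open>The uniformly random output index\<close>

text \<open>Split along the value of \<open>\<tau>\<close>: almost surely the output term is the sum
  of \<open>I t \<omega> * G t \<omega>\<close> over \<open>t \<le> m\<close>. Each expectation
  factors by independence, and each indicator has mean \<open>1 / (real m + 1)\<close>. Independence
  is stated through generated sigma-algebras because \<open>\<tau>\<close> and the sample family
  have different value types.\<close>

lemma uniform_output:
  assumes \<tau>: "\<tau> \<in> measurable M (count_space UNIV)"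
    and ind: "M.indep_set (sets (vimage_algebra (space M) \<tau> (count_space UNIV)))
      (sets (vimage_algebra (space M) (\<lambda>\<omega>. \<lambda>j\<in>{1..b} <+> {1..}. case_sum \<zeta> \<xi> j \<omega>)
        (PiM ({1..b} <+> {1..}) (\<lambda>_. D))))"
    and unif: "distr M (count_space UNIV) \<tau> = measure_pmf (pmf_of_set {0..m})"
  shows "has_bochner_integral M (\<lambda>\<omega>. (norm (grad F (w (\<tau> \<omega>) \<omega>)))\<^sup>2)
    ((\<Sum>t\<le>m. \<integral>\<omega>. (norm (grad F (w t \<omega>)))\<^sup>2 \<partial>M) / (real m + 1))"
proof -
  let ?J = "{1..b} <+> {1..} :: (nat + nat) set"
  let ?Y = "\<lambda>\<omega>. \<lambda>j\<in>?J. case_sum \<zeta> \<xi> j \<omega>"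
  let ?V\<tau> = "vimage_algebra (space M) \<tau> (count_space UNIV)"
  let ?VY = "vimage_algebra (space M) ?Y (PiM ?J (\<lambda>_. D))"
  define G where "G t \<omega> = (norm (grad F (w t \<omega>)))\<^sup>2" for t \<omega>
  define I where "I t \<omega> = (indicator {t} (\<tau> \<omega>) :: real)" for t \<omega>
  have [measurable]: "G t \<in> borel_measurable M" for t
    unfolding G_def by measurable
  have [measurable]: "I t \<in> borel_measurable M" for t
    unfolding I_def by (rule measurable_compose[OF \<tau>]) simp
  have "?Y \<in> space M \<rightarrow> space (PiM ?J (\<lambda>_. D))"
    using measurable_space[OF samples_measurable[OF order_refl]] by auto
  then have YV: "?Y \<in> measurable ?VY (PiM ?J (\<lambda>_. D))"
    by (rule measurable_vimage_algebra1)
  have GV: "G t \<in> borel_measurable ?VY" for t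
  proof -
    have sub: "{1..b} <+> {1..t} \<subseteq> ?J" by auto
    show ?thesis
      unfolding G_def w_eq_w_of[OF sub]
      by (rule measurable_compose[OF YV])
         (use state_measurable(1)[OF sub] in \<open>intro borel_measurable_power
          measurable_compose[OF _ borel_measurable_norm]
          measurable_compose[OF _ grad_F_measurable]; simp\<close>)
  qed
  have IV: "I t \<in> borel_measurable ?V\<tau>" for t
    unfolding I_def
    by (rule measurable_compose[OF measurable_vimage_algebra1]) auto
  \<comment> \<open>A function measurable for a smaller sigma-algebra generates a part of it, so
    independence descends from \<open>\<tau>\<close> and the samples to the real variables
    \<open>I t\<close> and \<open>G t\<close>.\<close>
  have sub: "sigma_sets (space M) {Z -` A \<inter> space M |A. A \<in> sets borel} \<subseteq> sets V"
    if Z: "Z \<in> borel_measurable V" and V: "space V = space M" for Z :: "'o \<Rightarrow> real" and V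
  proof -
    have "{Z -` A \<inter> space V |A. A \<in> sets borel} \<subseteq> sets V"
      using measurable_sets[OF Z] by blast
    from sets.sigma_sets_subset[OF this] show ?thesis
      by (simp only: V)
  qed
  have "M.indep_var borel (I t) borel (G t)" for t
  proof -
    have "sigma_sets (space M) {I t -` A \<inter> space M |A. A \<in> sets borel} \<subseteq> sets ?V\<tau>"
      "sigma_sets (space M) {G t -` A \<inter> space M |A. A \<in> sets borel} \<subseteq> sets ?VY"
      by (intro sub IV GV space_vimage_algebra)+
    with ind have "M.indep_set
        (sigma_sets (space M) {I t -` A \<inter> space M |A. A \<in> sets borel})
        (sigma_sets (space M) {G t -` A \<inter> space M |A. A \<in> sets borel})"
      unfolding M.indep_sets2_eq by (meson subset_trans subsetD)
    then show ?thesis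
      unfolding M.indep_var_eq by simp
  qed
  moreover have "integrable M (I t)" for t
    by (rule M.integrable_const_bound[where B = 1]) (auto simp: I_def indicator_def)
  moreover have "integrable M (G t)" for t
    unfolding G_def by (rule second_moments)
  ultimately have prod: "integrable M (\<lambda>\<omega>. I t \<omega> * G t \<omega>)"
    "(\<integral>\<omega>. I t \<omega> * G t \<omega> \<partial>M) = (\<integral>\<omega>. I t \<omega> \<partial>M) * (\<integral>\<omega>. G t \<omega> \<partial>M)" for t
    by (auto intro: M.indep_var_integrable M.indep_var_lebesgue_integral)
  have EI: "(\<integral>\<omega>. I t \<omega> \<partial>M) = 1 / (real m + 1)" if "t \<le> m" for t
  proof -
    have "(\<integral>\<omega>. I t \<omega> \<partial>M) = (\<integral>s. indicator {t} s \<partial>distr M (count_space UNIV) \<tau>)"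
      unfolding I_def using \<tau> by (subst integral_distr) auto
    also have "\<dots> = pmf (pmf_of_set {0..m}) t"
      unfolding unif by (simp add: measure_pmf_single)
    finally show ?thesis
      using that by simp
  qed
  \<comment> \<open>The law of \<open>\<tau>\<close> only excludes values above \<open>m\<close> up
    to a null set, so the decomposition holds almost everywhere.\<close>
  have "AE s in distr M (count_space UNIV) \<tau>. s \<le> m"
    unfolding unif by (simp add: AE_measure_pmf_iff)
  then have "AE \<omega> in M. \<tau> \<omega> \<le> m"
    using \<tau> by (simp add: AE_distr_iff)
  then have ae: "AE \<omega> in M. (\<Sum>t\<le>m. I t \<omega> * G t \<omega>) = G (\<tau> \<omega>) \<omega>"
    by eventually_elim (simp add: I_def indicator_def sum.delta' if_distrib cong: if_cong)
  have m1: "(\<lambda>\<omega>. G (\<tau> \<omega>) \<omega>) \<in> borel_measurable M"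
    using \<tau> by (rule measurable_compose_countable[rotated]) measurable
  have "has_bochner_integral M (\<lambda>\<omega>. \<Sum>t\<le>m. I t \<omega> * G t \<omega>)
      (\<Sum>t\<le>m. (\<integral>\<omega>. I t \<omega> \<partial>M) * (\<integral>\<omega>. G t \<omega> \<partial>M))"
    by (intro has_bochner_integral_sum) (simp add: has_bochner_integral_iff prod)
  also have "(\<Sum>t\<le>m. (\<integral>\<omega>. I t \<omega> \<partial>M) * (\<integral>\<omega>. G t \<omega> \<partial>M))
      = (\<Sum>t\<le>m. \<integral>\<omega>. G t \<omega> \<partial>M) / (real m + 1)"
    by (simp add: EI sum_divide_distrib)
  finally have "has_bochner_integral M (\<lambda>\<omega>. G (\<tau> \<omega>) \<omega>) ((\<Sum>t\<le>m. \<integral>\<omega>. G t \<omega> \<partial>M) / (real m + 1))"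
    using has_bochner_integral_cong_AE[OF _ m1 ae] by simp
  then show ?thesis
    unfolding G_def .
qed

end

section \<open>From the summed bound to the rate for the random output\<close>

theorem theorem2:
  fixes f :: "real ^ 'n \<Rightarrow> 'x \<Rightarrow> real"
    and D :: "'x measure"
    and M :: "'o measure"
    and \<zeta> \<xi> :: "nat \<Rightarrow> 'o \<Rightarrow> 'x"
    and \<tau> :: "'o \<Rightarrow> nat"
    and w\<^sub>0 :: "real ^ 'n"
    and L \<eta> Fstar :: real
    and m b :: nat
  defines "F \<equiv> expected_loss D f"
    and "wtilde \<equiv> (\<lambda>\<omega>. isarah_w f w\<^sub>0 \<eta> b (\<lambda>i. \<zeta> i \<omega>) (\<lambda>t. \<xi> t \<omega>) (\<tau> \<omega>))"
  assumes "prob_space D"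
    and "\<And>x w. x \<in> space D \<Longrightarrow> (\<lambda>u. f u x) differentiable (at w)"
    and "\<And>w. integrable D (f w)"
    and "\<And>w. F differentiable (at w)"
    and "\<And>w. has_bochner_integral D (\<lambda>x. grad (\<lambda>u. f u x) w) (grad F w)"
    and "\<And>w. Fstar \<le> F w"
    and "L > 0"
    and "\<And>x w w'. x \<in> space D \<Longrightarrow>
           norm (grad (\<lambda>u. f u x) w - grad (\<lambda>u. f u x) w') \<le> L * norm (w - w')"
    and "integrable D (\<lambda>x. (norm (grad (\<lambda>u. f u x) w\<^sub>0))\<^sup>2)"
    and "prob_space M"
    and "prob_space.indep_vars M (\<lambda>_. D) (case_sum \<zeta> \<xi>) ({1..b} <+> {1..})"
    and "\<And>i. i \<in> {1..b} \<Longrightarrow> distr M D (\<zeta> i) = D"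
    and "\<And>t. t \<ge> 1 \<Longrightarrow> distr M D (\<xi> t) = D"
    and "\<tau> \<in> measurable M (count_space UNIV)"
    and "prob_space.indep_set M
           (sets (vimage_algebra (space M) \<tau> (count_space UNIV)))
           (sets (vimage_algebra (space M)
              (\<lambda>\<omega>. \<lambda>j\<in>{1..b} <+> {1..}. case_sum \<zeta> \<xi> j \<omega>)
              (PiM ({1..b} <+> {1..}) (\<lambda>_. D))))"
    and "distr M (count_space UNIV) \<tau> = measure_pmf (pmf_of_set {0..m})"
    and "m \<ge> 1"
    and "real b = sqrt (real m + 1)"
    and "0 < \<eta>"
    and "\<eta> \<le> 2 / (L * (sqrt (1 + 4 * real m) + 1))"
  shows "2 / (L * (sqrt (1 + 4 * real m) + 1)) \<le> 1 / L
    \<and> integrable M (\<lambda>\<omega>. (norm (grad F (wtilde \<omega>)))\<^sup>2)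
    \<and> (\<integral>\<omega>. (norm (grad F (wtilde \<omega>)))\<^sup>2 \<partial>M)
        \<le> 2 / (\<eta> * (real m + 1)) * (F w\<^sub>0 - Fstar)
          + 1 / sqrt (real m + 1) * (\<integral>x. (norm (grad (\<lambda>u. f u x) w\<^sub>0))\<^sup>2 \<partial>D)"
proof -
  note assms' = assms(3-)[unfolded F_def]
  interpret D: prob_space D by (rule assms)
  interpret M: prob_space M by (rule assms)
  have b: "b > 0"
    using \<open>real b = sqrt (real m + 1)\<close> by (cases "b = 0") auto
  interpret isarah D M f \<zeta> \<xi> w\<^sub>0 L \<eta> b
    by unfold_locales (use b assms' in auto)
  have "real m * (L * \<eta>)\<^sup>2 \<le> 1 - L * \<eta>"
    by (rule isarah_step_size) (use assms in auto)
  then have "(\<Sum>t\<le>m. \<integral>\<omega>. (norm (grad F (w t \<omega>)))\<^sup>2 \<partial>M)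
      \<le> 2 / \<eta> * (F w\<^sub>0 - Fstar) + (real m + 1) * (\<sigma> / b)"
    unfolding F_def using assms' by (intro sum_grad_norm_sq_bound) auto
  then have "(\<Sum>t\<le>m. \<integral>\<omega>. (norm (grad F (w t \<omega>)))\<^sup>2 \<partial>M) / (real m + 1)
      \<le> (2 / \<eta> * (F w\<^sub>0 - Fstar) + (real m + 1) * (\<sigma> / b)) / (real m + 1)"
    by (intro divide_right_mono) auto
  \<comment> \<open>Averaging cancels the factor \<open>real m + 1\<close> in front of
    \<open>\<sigma> / b\<close>, and the batch size \<open>b\<close> is the square root in the final
    coefficient.\<close>
  also have "\<dots> = 2 / (\<eta> * (real m + 1)) * (F w\<^sub>0 - Fstar) + 1 / sqrt (real m + 1) * \<sigma>"
    unfolding \<open>real b = sqrt (real m + 1)\<close>[symmetric]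
    by (simp add: add_divide_distrib)
  finally have bound: "(\<Sum>t\<le>m. \<integral>\<omega>. (norm (grad F (w t \<omega>)))\<^sup>2 \<partial>M) / (real m + 1)
      \<le> 2 / (\<eta> * (real m + 1)) * (F w\<^sub>0 - Fstar) + 1 / sqrt (real m + 1) * \<sigma>" .
  have "has_bochner_integral M (\<lambda>\<omega>. (norm (grad F (wtilde \<omega>)))\<^sup>2)
      ((\<Sum>t\<le>m. \<integral>\<omega>. (norm (grad F (w t \<omega>)))\<^sup>2 \<partial>M) / (real m + 1))"
    unfolding F_def wtilde_def by (rule uniform_output) fact+
  moreover have "2 / (L * (sqrt (1 + 4 * real m) + 1)) \<le> 1 / L"
  proof -
    \<comment> \<open>The square root is at least 1, so the denominator is at least
      \<open>L * 2\<close>.\<close>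
    have "2 / (L * (sqrt (1 + 4 * real m) + 1)) \<le> 2 / (L * 2)"
      using \<open>L > 0\<close> by (intro divide_left_mono mult_left_mono mult_pos_pos add_nonneg_pos) auto
    then show ?thesis by simp
  qed
  ultimately show ?thesis
    using bound by (simp add: has_bochner_integral_iff)
qed

end
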